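(* Let $f\in L^2_{\rm loc}([0,\infty);L^2(\Omega)^3)$ be time-periodic with period $1$, let $h>0$, $\tau=1/T_1$ with $T_1\in\mathbb N$, set $$R_0(\Omega,f):=\frac{1}{1-e^{-A^{-2}}}\Big(\frac{1-e^{-2A^{-2}}}{2A^{-2}}\Big)^{1/2}\|f\|_{L^2([0,1];L^2(\Omega)^3)},$$ let $R\ge R_0(\Omega,f)$ and $\tilde U_R:=\{\tilde u:\Omega_h\to\mathbb R^3\mid\|\tilde u\|_{\Omega_h}\le R,\ \tilde u|_{\partial\Omega_h}=0\}$. Suppose that $\tilde u^n,u^n$ is a solution of the discrete Navier-Stokes equations (see context) with $\tilde u^0\in\tilde U_R$ such that $$|\tilde u^n(x)|\le\beta_0:=\frac{A^{-1}}{4}\quad\text{for all }x\in\Omega_h\text{ and }n\in\mathbb N.$$ Let $\tilde w^n,w^n$ be an arbitrary solution of the discrete Navier-Stokes equations with $\tilde w^0\in\tilde U_R$, $\tilde w^0\ne\tilde u^0$. Then $$\|\tilde w^n-\tilde u^n\|_{\Omega_h}\le e^{-\frac{A^{-2}}{2}n\tau}\|\tilde w^0-\tilde u^0\|_{\Omega_h}\quad\text{for all }n\in\mathbb N\cup\{0\}.$$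
   Context: $\Omega\subset\mathbb R^3$ is a bounded connected open set with Lipschitz boundary; $e^1,e^2,e^3$ is the standard basis of $\mathbb R^3$. Grid: for $h>0$ and $B\subset h\mathbb Z^3$, $\partial B:=\{x\in B\mid \{x\pm he^i\}_{i=1,2,3}\not\subset B\}$. $C_r(x):=\prod_{i=1}^3[x_i-\frac r2,x_i+\frac r2]$ and $\Omega_h:=\{x\in\Omega\cap h\mathbb Z^3\mid C_{4h}(x)\subset\Omega\}$. Functions on $\Omega_h$ are extended by $0$ outside $\Omega_h$, and $D_i^+\phi(x)=\frac{\phi(x+he^i)-\phi(x)}{h}$, $D_i\phi(x)=\frac{\phi(x+he^i)-\phi(x-he^i)}{2h}$, $D_i^2\phi(x)=\frac{\phi(x+he^i)+\phi(x-he^i)-2\phi(x)}{h^2}$, $\mathcal D\phi=(D_1\phi,D_2\phi,D_3\phi)$, $\mathcal D\cdot w=\sum_iD_iw_i$. Norm: $\|u\|_{\Omega_h}=(\sum_{x\in\Omega_h}|u(x)|^2h^3)^{1/2}$. $h\mathbb Z^3$ is partitioned into the eight parity classes $G^1,\dots,G^8$ (points $hz$ according to the parities of $z_1,z_2,z_3$). $\Omega_h^\circ:=\{x\in\Omega_h\setminus\partial\Omega_h\mid x+\sum_ia^ihe^i\in\Omega_h\setminus\partial\Omega_h \text{ for all } a^1,a^2,a^3\in\{0,1,2\}\}$, $\Omega_h^{\circ j}:=\Omega_h^\circ\cap G^j$. Standing assumption: $h$ is small enough that each $\Omega_h^{\circ j}$ is connected (via steps in $\{\pm2he^i\}$). Discrete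 Helmholtz-Hodge decomposition: for each $u:\Omega_h\to\mathbb R^3$ there are $w:\Omega_h\to\mathbb R^3$, $\phi:\Omega_h\to\mathbb R$ with $\mathcal D\cdot w=0$ on $\Omega_h$, $w+\mathcal D\phi=u$ on $\Omega_h\setminus\partial\Omega_h$, $w=0$ on $\partial\Omega_h$, $\sum_{x\in\Omega_h^{\circ j}}\phi(x)=0$ ($j=1,\dots,8$); $w$ is uniquely determined and $P_hu:=w$. Discrete Navier-Stokes equations: with $f^n(x):=\tau^{-1}h^{-3}\int_{\tau n}^{\tau(n+1)}\int_{C_h(x)}f(t,y)\,dy\,dt$ and given $\tilde u^0:\Omega_h\to\mathbb R^3$, put $u^0=P_h\tilde u^0$ and for $n\ge0$ $$\frac{\tilde u^{n+1}(x)-u^n(x)}{\tau}=-\frac12\sum_{j=1}^3\Big(u^n_j(x-he^j)D_j\tilde u^{n+1}(x-he^j)+u^n_j(x+he^j)D_j\tilde u^{n+1}(x+he^j)\Big)+\sum_{j=1}^3D_j^2\tilde u^{n+1}(x)+f^n(x)$$ for $x\in\Omega_h\setminus\partial\Omega_h$, $\tilde u^{n+1}=0$ on $\partial\Omega_h$, $u^{n+1}=P_h\tilde u^{n+1}$. (These are uniquely solvable for all $n$.) $A>0$ is a constant depending only on the diameter of $\Omega$ such that $\sum_{x\in\Omega_h}|\phi(x)|^2\le A^2\sum_{x\in\Omega_h\setminus\partial\Omega_h}|D_i^+\phi(x)|^2$ for $i=1,2,3$ and every $\phi:\Omega_h\to\mathbb R$ with $\phi|_{\partial\Omega_h}=0$.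 *)

theory Defs
  imports "HOL-Analysis.Analysis"
begin

(* Near each boundary point the set is, after a rotation or reflection T, the part of a ball
   lying strictly above the graph of a Lipschitz function of two variables. *)
definition lipschitz_boundary :: "(real^3) set \<Rightarrow> bool" where
  "lipschitz_boundary \<Omega> \<longleftrightarrow>
     (\<forall>p\<in>frontier \<Omega>. \<exists>(T :: real^3 \<Rightarrow> real^3) r L (g :: real^2 \<Rightarrow> real).
        orthogonal_transformation T \<and> 0 < r \<and> lipschitz_on L UNIV g \<and>
        (\<forall>y. p + T y \<in> ball p r \<longrightarrow> (p + T y \<in> \<Omega> \<longleftrightarrow> g (vector [y$1, y$2]) < y$3)))"

definition lipschitz_domain :: "(real^3) set \<Rightarrow> bool" where
  "lipschitz_domain \<Omega> \<longleftrightarrow> bounded \<Omega> \<and> connected \<Omega> \<and> open \<Omega> \<and> lipschitz_boundary \<Omega>"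

definition scaled_point :: "real \<Rightarrow> int^3 \<Rightarrow> real^3" where
  "scaled_point h z = (\<chi> i. h * of_int (z$i))"

definition grid :: "real \<Rightarrow> (real^3) set" where
  "grid h = range (scaled_point h)"

abbreviation step :: "real \<Rightarrow> 3 \<Rightarrow> real^3" where
  "step h i \<equiv> axis i h"

definition cube :: "real \<Rightarrow> real^3 \<Rightarrow> (real^3) set" where
  "cube r x = cbox (\<chi> i. x$i - r/2) (\<chi> i. x$i + r/2)"

definition grid_boundary :: "real \<Rightarrow> (real^3) set \<Rightarrow> (real^3) set" where
  "grid_boundary h B = {x\<in>B. \<not> (\<Union>i. {x + step h i, x - step h i}) \<subseteq> B}"

definition grid_domain :: "(real^3) set \<Rightarrow> real \<Rightarrow> (real^3) set" where
  "grid_domain \<Omega> h = {x \<in> \<Omega> \<inter> grid h. cube (4*h) x \<subseteq> \<Omega>}"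

abbreviation bdry :: "(real^3) set \<Rightarrow> real \<Rightarrow> (real^3) set" where
  "bdry \<Omega> h \<equiv> grid_boundary h (grid_domain \<Omega> h)"

abbreviation inner_grid :: "(real^3) set \<Rightarrow> real \<Rightarrow> (real^3) set" where
  "inner_grid \<Omega> h \<equiv> grid_domain \<Omega> h - bdry \<Omega> h"

(* The eight parity classes are indexed by p :: 3 => bool, where p i says that the i-th
   integer coordinate is even. *)
definition parity_class :: "real \<Rightarrow> (3 \<Rightarrow> bool) \<Rightarrow> (real^3) set" where
  "parity_class h p = {scaled_point h z | z. \<forall>i. even (z$i) \<longleftrightarrow> p i}"

definition grid_core :: "(real^3) set \<Rightarrow> real \<Rightarrow> (real^3) set" where
  "grid_core \<Omega> h = {x \<in> inner_grid \<Omega> h.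
     \<forall>a :: 3 \<Rightarrow> nat. (\<forall>i. a i \<in> {0, 1, 2}) \<longrightarrow>
       x + (\<Sum>i\<in>UNIV. real (a i) *\<^sub>R step h i) \<in> inner_grid \<Omega> h}"

abbreviation core_class :: "(real^3) set \<Rightarrow> real \<Rightarrow> (3 \<Rightarrow> bool) \<Rightarrow> (real^3) set" where
  "core_class \<Omega> h p \<equiv> grid_core \<Omega> h \<inter> parity_class h p"

definition double_step_connected :: "real \<Rightarrow> (real^3) set \<Rightarrow> bool" where
  "double_step_connected h S \<longleftrightarrow>
     (\<forall>x\<in>S. \<forall>y\<in>S. (x, y) \<in>
        {(a, b). a \<in> S \<and> b \<in> S \<and>
           (\<exists>i. b = a + 2 *\<^sub>R step h i \<or> b = a - 2 *\<^sub>R step h i)}\<^sup>*)"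

(* A function on the grid domain is represented by its extension by 0 to the whole space. *)
definition grid_fun :: "(real^3) set \<Rightarrow> real \<Rightarrow> (real^3 \<Rightarrow> 'a::real_normed_vector) \<Rightarrow> bool" where
  "grid_fun \<Omega> h u \<longleftrightarrow> (\<forall>x. x \<notin> grid_domain \<Omega> h \<longrightarrow> u x = 0)"

definition fwd_diff :: "real \<Rightarrow> 3 \<Rightarrow> (real^3 \<Rightarrow> 'a::real_normed_vector) \<Rightarrow> real^3 \<Rightarrow> 'a" where
  "fwd_diff h i \<phi> x = (\<phi> (x + step h i) - \<phi> x) /\<^sub>R h"

definition ctr_diff :: "real \<Rightarrow> 3 \<Rightarrow> (real^3 \<Rightarrow> 'a::real_normed_vector) \<Rightarrow> real^3 \<Rightarrow> 'a" where
  "ctr_diff h i \<phi> x = (\<phi> (x + step h i) - \<phi> (x - step h i)) /\<^sub>R (2*h)"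

definition snd_diff :: "real \<Rightarrow> 3 \<Rightarrow> (real^3 \<Rightarrow> 'a::real_normed_vector) \<Rightarrow> real^3 \<Rightarrow> 'a" where
  "snd_diff h i \<phi> x = (\<phi> (x + step h i) + \<phi> (x - step h i) - 2 *\<^sub>R \<phi> x) /\<^sub>R h\<^sup>2"

definition grid_grad :: "real \<Rightarrow> (real^3 \<Rightarrow> real) \<Rightarrow> real^3 \<Rightarrow> real^3" where
  "grid_grad h \<phi> x = (\<chi> i. ctr_diff h i \<phi> x)"

definition grid_div :: "real \<Rightarrow> (real^3 \<Rightarrow> real^3) \<Rightarrow> real^3 \<Rightarrow> real" where
  "grid_div h w x = (\<Sum>i\<in>UNIV. ctr_diff h i (\<lambda>y. w y $ i) x)"

definition grid_norm :: "(real^3) set \<Rightarrow> real \<Rightarrow> (real^3 \<Rightarrow> real^3) \<Rightarrow> real" where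
  "grid_norm \<Omega> h u = sqrt (\<Sum>x\<in>grid_domain \<Omega> h. (norm (u x))\<^sup>2 * h^3)"

definition discrete_poincare :: "(real^3) set \<Rightarrow> real \<Rightarrow> real \<Rightarrow> bool" where
  "discrete_poincare \<Omega> h A \<longleftrightarrow>
     (\<forall>i. \<forall>\<phi> :: real^3 \<Rightarrow> real. grid_fun \<Omega> h \<phi> \<and> (\<forall>x\<in>bdry \<Omega> h. \<phi> x = 0) \<longrightarrow>
        (\<Sum>x\<in>grid_domain \<Omega> h. \<bar>\<phi> x\<bar>\<^sup>2) \<le> A\<^sup>2 * (\<Sum>x\<in>inner_grid \<Omega> h. \<bar>fwd_diff h i \<phi> x\<bar>\<^sup>2))"

definition helmholtz_hodge ::
  "(real^3) set \<Rightarrow> real \<Rightarrow> (real^3 \<Rightarrow> real^3) \<Rightarrow> (real^3 \<Rightarrow> real^3) \<Rightarrow> (real^3 \<Rightarrow> real) \<Rightarrow> bool" where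
  "helmholtz_hodge \<Omega> h u w \<phi> \<longleftrightarrow>
     grid_fun \<Omega> h w \<and> grid_fun \<Omega> h \<phi> \<and>
     (\<forall>x\<in>grid_domain \<Omega> h. grid_div h w x = 0) \<and>
     (\<forall>x\<in>inner_grid \<Omega> h. w x + grid_grad h \<phi> x = u x) \<and>
     (\<forall>x\<in>bdry \<Omega> h. w x = 0) \<and>
     (\<forall>p. (\<Sum>x\<in>core_class \<Omega> h p. \<phi> x) = 0)"

definition helmholtz_proj ::
  "(real^3) set \<Rightarrow> real \<Rightarrow> (real^3 \<Rightarrow> real^3) \<Rightarrow> real^3 \<Rightarrow> real^3" where
  "helmholtz_proj \<Omega> h u = (THE w. \<exists>\<phi>. helmholtz_hodge \<Omega> h u w \<phi>)"

(* Elements of the Bochner space L2_loc([0,oo); L2(\<Omega>)^3) are given by a jointly measurable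
   representative f t y, under the usual identification of L2(0,T; L2(\<Omega>)) with
   L2((0,T) x \<Omega>). Values for t < 0 or y outside \<Omega> are never used. *)
definition L2_loc :: "(real^3) set \<Rightarrow> (real \<Rightarrow> real^3 \<Rightarrow> real^3) \<Rightarrow> bool" where
  "L2_loc \<Omega> f \<longleftrightarrow>
     (\<lambda>(t, y). f t y) \<in> borel_measurable (lebesgue_on ({0..} \<times> \<Omega>)) \<and>
     (\<forall>T>0. integrable (lebesgue_on ({0..T} \<times> \<Omega>)) (\<lambda>(t, y). (norm (f t y))\<^sup>2))"

definition time_periodic :: "(real^3) set \<Rightarrow> (real \<Rightarrow> real^3 \<Rightarrow> real^3) \<Rightarrow> bool" where
  "time_periodic \<Omega> f \<longleftrightarrow> (AE (t, y) in lebesgue_on ({0..} \<times> \<Omega>). f (t + 1) y = f t y)"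

definition L2_norm_period :: "(real^3) set \<Rightarrow> (real \<Rightarrow> real^3 \<Rightarrow> real^3) \<Rightarrow> real" where
  "L2_norm_period \<Omega> f =
     sqrt (LINT t:{0..1}|lebesgue. LINT y:\<Omega>|lebesgue. (norm (f t y))\<^sup>2)"

definition R0 :: "real \<Rightarrow> (real^3) set \<Rightarrow> (real \<Rightarrow> real^3 \<Rightarrow> real^3) \<Rightarrow> real" where
  "R0 A \<Omega> f = 1 / (1 - exp (- (1/A\<^sup>2)))
     * sqrt ((1 - exp (- 2 * (1/A\<^sup>2))) / (2 * (1/A\<^sup>2))) * L2_norm_period \<Omega> f"

definition mean_force ::
  "real \<Rightarrow> real \<Rightarrow> (real \<Rightarrow> real^3 \<Rightarrow> real^3) \<Rightarrow> nat \<Rightarrow> real^3 \<Rightarrow> real^3" where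
  "mean_force h \<tau> f n x =
     (LINT t:{\<tau> * real n..\<tau> * (real n + 1)}|lebesgue. LINT y:cube h x|lebesgue. f t y) /\<^sub>R (\<tau> * h^3)"

(* ut n and u n are the fields with and without tilde, so the data is ut 0. *)
definition discrete_NS ::
  "(real^3) set \<Rightarrow> real \<Rightarrow> real \<Rightarrow> (real \<Rightarrow> real^3 \<Rightarrow> real^3) \<Rightarrow>
   (nat \<Rightarrow> real^3 \<Rightarrow> real^3) \<Rightarrow> (nat \<Rightarrow> real^3 \<Rightarrow> real^3) \<Rightarrow> bool" where
  "discrete_NS \<Omega> h \<tau> f ut u \<longleftrightarrow>
     (\<forall>n. grid_fun \<Omega> h (ut n)) \<and>
     (\<forall>n. u n = helmholtz_proj \<Omega> h (ut n)) \<and>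
     (\<forall>n. \<forall>x\<in>bdry \<Omega> h. ut (Suc n) x = 0) \<and>
     (\<forall>n. \<forall>x\<in>inner_grid \<Omega> h.
        (ut (Suc n) x - u n x) /\<^sub>R \<tau> =
          - ((1/2) *\<^sub>R (\<Sum>j\<in>UNIV.
               (u n (x - step h j) $ j) *\<^sub>R ctr_diff h j (ut (Suc n)) (x - step h j)
             + (u n (x + step h j) $ j) *\<^sub>R ctr_diff h j (ut (Suc n)) (x + step h j)))
          + (\<Sum>j\<in>UNIV. snd_diff h j (ut (Suc n)) x)
          + mean_force h \<tau> f n x)"

definition U_ball :: "(real^3) set \<Rightarrow> real \<Rightarrow> real \<Rightarrow> (real^3 \<Rightarrow> real^3) set" where
  "U_ball \<Omega> h R =
     {v. grid_fun \<Omega> h v \<and> grid_norm \<Omega> h v \<le> R \<and> (\<forall>x\<in>bdry \<Omega> h. v x = 0)}"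

end

theory Submission
  imports Defs
begin

text \<open>The force is common to both solutions, so it cancels in the equation for
  \<open>b\<close>, the difference of the new tilde iterates, and \<open>E\<close>, the difference
  of the old projected fields. This equation is paired with \<open>b\<close> and summed over the
  grid; the extension by 0 leaves no boundary terms. The convection difference splits in two.
  Transport of \<open>b\<close> by \<open>w n\<close> contributes nothing, because
  \<open>w n\<close> is discretely divergence-free (\<open>convection_form_antisym\<close>). In the
  transport of \<open>ut (Suc n)\<close> by \<open>E\<close>, antisymmetry moves the difference
  quotient onto \<open>b\<close>; the bound \<beta> = 1/(4A) on \<open>ut\<close> and Young's
  inequality then bound it by \<beta>^2 |E|^2 plus the viscous energy G of \<open>b\<close>
  (\<open>convection_form_le\<close>, \<open>sum_ctr_diff_le\<close>). The factor 1/2 of the scheme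
  leaves half of G as damping.

  The Poincare inequality, used in three directions, gives G \<ge> 3 A^-2 |b|^2
  (\<open>poincare_energy\<close>). With s = A^-2 \<tau> this yields (1 + 3s) |b|^2 \<le> (1 + s/16)
  |E|^2. The projection is orthogonal and hence nonexpansive
  (\<open>helmholtz_hodge_diff_energy\<close>), so |E| is at most the old tilde difference. For 0
  \<le> s \<le> 1 the quotient of the factors is at most exp(-s) (\<open>exp_mult_le\<close>); a
  square root and induction on n give the decay.

  Two facts about the setting are established as well: the projection, given by a description
  operator, really is the solenoidal part of a decomposition (\<open>helmholtz_proj_hodge\<close>),
  and max(1, 2 diam) is an admissible Poincare constant
  (\<open>discrete_poincare_diameter\<close>).\<close>

section \<open>Translations of finite sums\<close>

text \<open>Since both functions vanish off \<open>S\<close>, the sums effectively run over the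
  whole group, where translation is free. Every summation by parts below rests on this.\<close>

lemma sum_inner_shift:
  fixes p q :: "'a::ab_group_add \<Rightarrow> 'b::real_inner"
  assumes S: "finite S" and p: "\<And>x. x \<notin> S \<Longrightarrow> p x = 0" and q: "\<And>x. x \<notin> S \<Longrightarrow> q x = 0"
  shows "(\<Sum>x\<in>S. p x \<bullet> q (x + a)) = (\<Sum>x\<in>S. p (x - a) \<bullet> q x)"
proof -
  have "(\<Sum>x\<in>S. p x \<bullet> q (x + a)) = (\<Sum>x | x \<in> S \<and> x + a \<in> S. p x \<bullet> q (x + a))"
    using S q by (intro sum.mono_neutral_right) auto
  also have "\<dots> = (\<Sum>x | x \<in> S \<and> x - a \<in> S. p (x - a) \<bullet> q x)"
    by (rule sum.reindex_bij_witness[where i = "\<lambda>x. x - a" and j = "\<lambda>x. x + a"]) auto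
  also have "\<dots> = (\<Sum>x\<in>S. p (x - a) \<bullet> q x)"
    using S p by (intro sum.mono_neutral_left) auto
  finally show ?thesis .
qed

text \<open>Translating the window of summation can only lose nonnegative mass: the translate of
  \<open>S\<close> may miss part of the support.\<close>

lemma sum_shift_le:
  fixes f :: "'a::ab_group_add \<Rightarrow> real"
  assumes S: "finite S" and f: "\<And>x. x \<notin> S \<Longrightarrow> f x = 0" "\<And>x. 0 \<le> f x"
  shows "(\<Sum>x\<in>S. f (x + a)) \<le> (\<Sum>x\<in>S. f x)"
proof -
  have "(\<Sum>x\<in>S. f (x + a)) = (\<Sum>x\<in>(\<lambda>x. x + a) ` S. f x)"
    by (subst sum.reindex) (auto simp: inj_on_def)
  also have "\<dots> = (\<Sum>x\<in>(\<lambda>x. x + a) ` S \<inter> S. f x)"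
    using S f by (intro sum.mono_neutral_right) auto
  also have "\<dots> \<le> (\<Sum>x\<in>S. f x)"
    using S f by (intro sum_mono2) auto
  finally show ?thesis .
qed

lemma sum_shift_eq:
  fixes f :: "'a::ab_group_add \<Rightarrow> real"
  assumes S: "finite S" and f: "\<And>x. f x \<noteq> 0 \<Longrightarrow> x \<in> S \<and> x - a \<in> S"
  shows "(\<Sum>x\<in>S. f (x + a)) = (\<Sum>x\<in>S. f x)"
proof -
  have "(\<Sum>x\<in>S. f (x + a)) = (\<Sum>x\<in>(\<lambda>x. x + a) ` S. f x)"
    by (subst sum.reindex) (auto simp: inj_on_def)
  also have "\<dots> = (\<Sum>x\<in>(\<lambda>x. x + a) ` S \<inter> S. f x)"
    using S f by (intro sum.mono_neutral_right) auto
  also have "\<dots> = (\<Sum>x\<in>S. f x)"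
    using S f by (intro sum.mono_neutral_left) (auto simp: image_iff, metis diff_add_cancel)
  finally show ?thesis .
qed

section \<open>The grid domain and its Poincare inequality\<close>

lemma finite_grid_domain:
  assumes "bounded \<Omega>" "0 < h"
  shows "finite (grid_domain \<Omega> h)"
proof -
  obtain B where B: "\<And>x. x \<in> \<Omega> \<Longrightarrow> norm x \<le> B"
    using assms(1) unfolding bounded_iff by blast
  define F where "F = {-\<lceil>B/h\<rceil>..\<lceil>B/h\<rceil>}"
  have fin: "finite (scaled_point h ` vec_lambda ` (PiE UNIV (\<lambda>_. F)))"
    by (intro finite_imageI finite_PiE) (auto simp: F_def)
  have "grid_domain \<Omega> h \<subseteq> scaled_point h ` vec_lambda ` (PiE UNIV (\<lambda>_. F))"
  proof
    fix x assume "x \<in> grid_domain \<Omega> h"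
    then obtain z where z: "x = scaled_point h z" and x: "x \<in> \<Omega>"
      by (auto simp: grid_domain_def grid_def)
    have "z $ i \<in> F" for i
    proof -
      have "\<bar>x $ i\<bar> \<le> B" using B[OF x] component_le_norm_cart[of x i] by linarith
      hence "h * \<bar>of_int (z $ i)\<bar> \<le> B"
        using assms(2) by (simp add: z scaled_point_def abs_mult)
      hence "\<bar>of_int (z $ i)\<bar> \<le> B / h" using assms(2) by (simp add: field_simps)
      thus ?thesis unfolding F_def by (simp add: abs_le_iff) linarith
    qed
    hence "vec_nth z \<in> PiE UNIV (\<lambda>_. F)" by auto
    moreover have "x = scaled_point h (vec_lambda (vec_nth z))" by (simp add: z)
    ultimately show "x \<in> scaled_point h ` vec_lambda ` (PiE UNIV (\<lambda>_. F))" by blast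
  qed
  thus ?thesis using fin finite_subset by blast
qed

lemma inner_grid_neighbours:
  assumes "x \<in> inner_grid \<Omega> h"
  shows "x + step h i \<in> grid_domain \<Omega> h" "x - step h i \<in> grid_domain \<Omega> h"
  using assms by (auto simp: grid_boundary_def)

text \<open>Weighting the telescoping sum of \<open>\<phi>\<^sup>2\<close> by the coordinate \<open>x $ i\<close>, measured from the
  lowest grid point, makes the terms at boundary points nonpositive, so that only differences
  based at inner points survive.\<close>

lemma discrete_poincare_diameter:
  assumes bd: "bounded \<Omega>" and h: "0 < h" and A: "2 * diameter \<Omega> \<le> A"
  shows "discrete_poincare \<Omega> h A"
  unfolding discrete_poincare_def
proof (intro allI impI, elim conjE)
  fix i and \<phi> :: "real^3 \<Rightarrow> real"
  assume gf: "grid_fun \<Omega> h \<phi>" and b0: "\<forall>x\<in>bdry \<Omega> h. \<phi> x = 0"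
  define S where "S = grid_domain \<Omega> h"
  define I where "I = inner_grid \<Omega> h"
  define d where "d = diameter \<Omega>"
  define a where "a = step h i"
  have S: "finite S" unfolding S_def by (rule finite_grid_domain[OF bd h])
  have IS: "I \<subseteq> S" by (auto simp: I_def S_def)
  have \<phi>0: "\<phi> x = 0" if "x \<notin> I" for x
    using that gf b0 by (auto simp: I_def grid_fun_def)
  have d0: "0 \<le> d" unfolding d_def by (rule diameter_ge_0[OF bd])
  show "(\<Sum>x\<in>grid_domain \<Omega> h. \<bar>\<phi> x\<bar>\<^sup>2) \<le> A\<^sup>2 * (\<Sum>x\<in>inner_grid \<Omega> h. \<bar>fwd_diff h i \<phi> x\<bar>\<^sup>2)"
  proof (cases "S = {}")
    case True
    thus ?thesis by (simp add: S_def[symmetric] sum_nonneg)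
  next
    case False
    define c where "c = Min ((\<lambda>x. x $ i) ` S)"
    have cle: "c \<le> x $ i" if "x \<in> S" for x unfolding c_def using that S by simp
    have "c \<in> (\<lambda>x. x $ i) ` S" unfolding c_def using S False by (intro Min_in) auto
    then obtain x0 where x0: "x0 \<in> S" "c = x0 $ i" by auto
    define \<eta> where "\<eta> x = x $ i - c" for x :: "real^3"
    have \<eta>0: "0 \<le> \<eta> x" if "x \<in> S" for x using cle[OF that] by (simp add: \<eta>_def)
    have \<eta>d: "\<eta> x \<le> d" if "x \<in> S" for x
    proof -
      have "\<eta> x \<le> norm (x - x0)" using component_le_norm_cart[of "x - x0" i] by (simp add: \<eta>_def x0(2))
      also have "\<dots> \<le> d" using diameter_bounded_bound[OF bd, of x x0] that x0(1)
        by (simp add: S_def grid_domain_def dist_norm d_def)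
      finally show ?thesis .
    qed
    have \<eta>a: "\<eta> (x + a) = \<eta> x + h" for x by (simp add: \<eta>_def a_def)
    have nb: "x - a \<in> S" if "x \<in> I" for x
      using inner_grid_neighbours(2)[of x \<Omega> h i] that by (simp add: I_def S_def a_def)
    define D where "D x = fwd_diff h i \<phi> x" for x
    have diff: "\<phi> (x + a) = \<phi> x + h * D x" for x
      using h by (simp add: D_def fwd_diff_def a_def field_simps)
    define P where "P = (\<Sum>x\<in>S. (\<phi> x)\<^sup>2)"
    \<comment> \<open>\<open>\<phi>\<close> lives on inner points, whose neighbours belong to the
      grid domain, so neither shifted sum loses a term.\<close>
    have e1: "(\<Sum>x\<in>S. (\<phi> (x + a))\<^sup>2) = P" unfolding P_def
      by (rule sum_shift_eq[OF S]) (use \<phi>0 nb IS in force)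
    have e2: "(\<Sum>x\<in>S. \<eta> (x + a) * (\<phi> (x + a))\<^sup>2) = (\<Sum>x\<in>S. \<eta> x * (\<phi> x)\<^sup>2)"
      by (rule sum_shift_eq[OF S, where f = "\<lambda>x. \<eta> x * (\<phi> x)\<^sup>2"]) (use \<phi>0 nb IS in force)
    \<comment> \<open>The weight \<open>\<eta>\<close> grows by exactly \<open>h\<close> per step,
      so \<open>P\<close> is a sum against the difference of \<open>\<eta>\<close>, ready for
      summation by parts.\<close>
    have "h * P = (\<Sum>x\<in>S. \<eta> (x + a) * (\<phi> (x + a))\<^sup>2 - \<eta> x * (\<phi> (x + a))\<^sup>2)"
      unfolding e1[symmetric] sum_distrib_left by (intro sum.cong) (auto simp: \<eta>a algebra_simps)
    also have "\<dots> = (\<Sum>x\<in>S. \<eta> x * ((\<phi> x)\<^sup>2 - (\<phi> (x + a))\<^sup>2))"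
      by (simp add: sum_subtractf e2 algebra_simps)
    also have "\<dots> \<le> (\<Sum>x\<in>I. \<eta> x * ((\<phi> x)\<^sup>2 - (\<phi> (x + a))\<^sup>2))"
    proof -
      have "(\<Sum>x\<in>S. \<eta> x * ((\<phi> x)\<^sup>2 - (\<phi> (x + a))\<^sup>2)) =
        (\<Sum>x\<in>S - I. \<eta> x * ((\<phi> x)\<^sup>2 - (\<phi> (x + a))\<^sup>2)) + (\<Sum>x\<in>I. \<eta> x * ((\<phi> x)\<^sup>2 - (\<phi> (x + a))\<^sup>2))"
        by (rule sum.subset_diff[OF IS S])
      moreover have "(\<Sum>x\<in>S - I. \<eta> x * ((\<phi> x)\<^sup>2 - (\<phi> (x + a))\<^sup>2)) \<le> 0"
        by (intro sum_nonpos) (use \<phi>0 \<eta>0 in auto)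
      ultimately show ?thesis by simp
    qed
    also have "\<dots> \<le> (\<Sum>x\<in>I. h * (2 * d\<^sup>2 * (D x)\<^sup>2 + ((\<phi> x)\<^sup>2 + (\<phi> (x + a))\<^sup>2) / 4))"
    proof (intro sum_mono)
      fix x assume "x \<in> I"
      hence xS: "x \<in> S" using IS by auto
      define s where "s = \<phi> x + \<phi> (x + a)"
      have eq: "\<eta> x * ((\<phi> x)\<^sup>2 - (\<phi> (x + a))\<^sup>2) = h * (- (\<eta> x * D x) * s)"
        unfolding s_def diff by (simp add: power2_eq_square algebra_simps)
      \<comment> \<open>Young's inequality with weights 2 and 1/8: the part with \<open>s\<close>
        then sums to at most \<open>P / 2\<close>, which the left side absorbs, and
        \<open>(2 * d)\<^sup>2\<close> is what remains in front of the differences.\<close>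
      have "- (\<eta> x * D x) * s \<le> 2 * (\<eta> x * D x)\<^sup>2 + s\<^sup>2 / 8"
        using zero_le_power2[of "4 * (\<eta> x * D x) + s"] by (simp add: power2_eq_square algebra_simps)
      moreover have "(\<eta> x * D x)\<^sup>2 \<le> d\<^sup>2 * (D x)\<^sup>2"
        unfolding power_mult_distrib using \<eta>0[OF xS] \<eta>d[OF xS] by (intro mult_right_mono power_mono) auto
      moreover have "s\<^sup>2 \<le> 2 * ((\<phi> x)\<^sup>2 + (\<phi> (x + a))\<^sup>2)"
        using zero_le_power2[of "\<phi> x - \<phi> (x + a)"] by (simp add: s_def power2_eq_square algebra_simps)
      ultimately have "- (\<eta> x * D x) * s \<le> 2 * d\<^sup>2 * (D x)\<^sup>2 + ((\<phi> x)\<^sup>2 + (\<phi> (x + a))\<^sup>2) / 4"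
        by linarith
      thus "\<eta> x * ((\<phi> x)\<^sup>2 - (\<phi> (x + a))\<^sup>2)
          \<le> h * (2 * d\<^sup>2 * (D x)\<^sup>2 + ((\<phi> x)\<^sup>2 + (\<phi> (x + a))\<^sup>2) / 4)"
        unfolding eq using h by (intro mult_left_mono) auto
    qed
    also have "\<dots> = h * (2 * d\<^sup>2 * (\<Sum>x\<in>I. (D x)\<^sup>2) + (\<Sum>x\<in>I. (\<phi> x)\<^sup>2 + (\<phi> (x + a))\<^sup>2) / 4)"
      by (simp only: sum_distrib_left[symmetric] sum.distrib sum_divide_distrib[symmetric])
    also have "\<dots> \<le> h * (2 * d\<^sup>2 * (\<Sum>x\<in>I. (D x)\<^sup>2) + (2 * P) / 4)"
    proof -
      have "(\<Sum>x\<in>I. (\<phi> x)\<^sup>2 + (\<phi> (x + a))\<^sup>2) \<le> (\<Sum>x\<in>S. (\<phi> x)\<^sup>2 + (\<phi> (x + a))\<^sup>2)"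
        using S IS by (intro sum_mono2) auto
      also have "\<dots> = 2 * P" by (simp add: sum.distrib e1) (simp add: P_def)
      finally show ?thesis using h by simp
    qed
    finally have "P \<le> (2 * d)\<^sup>2 * (\<Sum>x\<in>I. (D x)\<^sup>2)"
      using h by (simp add: power_mult_distrib)
    also have "\<dots> \<le> A\<^sup>2 * (\<Sum>x\<in>I. (D x)\<^sup>2)"
      using A d0 by (intro mult_right_mono power_mono sum_nonneg) (auto simp: d_def)
    finally show ?thesis by (simp add: P_def S_def I_def D_def)
  qed
qed

section \<open>Integration by parts for central differences\<close>

lemma ctr_diff_real: "ctr_diff h i \<phi> x = (\<phi> (x + step h i) - \<phi> (x - step h i)) / (2 * h)"
  for \<phi> :: "real^3 \<Rightarrow> real"
  unfolding ctr_diff_def real_scaleR_def by (rule divide_inverse_commute[symmetric])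

text \<open>The shifts by \<open>step h i\<close> and by its negative are adjoint to each other on
  functions vanishing off \<open>S\<close>, so each central difference is skew-adjoint.\<close>

lemma sum_inner_grid_grad:
  assumes S: "finite S" and w: "\<And>x. x \<notin> S \<Longrightarrow> w x = 0" and \<phi>: "\<And>x. x \<notin> S \<Longrightarrow> \<phi> x = 0"
  shows "(\<Sum>x\<in>S. w x \<bullet> grid_grad h \<phi> x) = - (\<Sum>x\<in>S. grid_div h w x * \<phi> x)"
proof -
  have comp: "(\<Sum>x\<in>S. w x $ i * ctr_diff h i \<phi> x) = - (\<Sum>x\<in>S. ctr_diff h i (\<lambda>y. w y $ i) x * \<phi> x)" for i
  proof -
    have 1: "(\<Sum>x\<in>S. w x $ i * \<phi> (x + step h i)) = (\<Sum>x\<in>S. w (x - step h i) $ i * \<phi> x)"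
      using sum_inner_shift[OF S, of "\<lambda>x. w x $ i" \<phi> "step h i"] w \<phi> by simp
    have 2: "(\<Sum>x\<in>S. w x $ i * \<phi> (x - step h i)) = (\<Sum>x\<in>S. w (x + step h i) $ i * \<phi> x)"
      using sum_inner_shift[OF S, of "\<lambda>x. w x $ i" \<phi> "- step h i"] w \<phi> by simp
    have "(\<Sum>x\<in>S. w x $ i * ctr_diff h i \<phi> x) =
      ((\<Sum>x\<in>S. w x $ i * \<phi> (x + step h i)) - (\<Sum>x\<in>S. w x $ i * \<phi> (x - step h i))) / (2*h)"
      unfolding sum_subtractf[symmetric] sum_divide_distrib
      by (simp add: ctr_diff_real right_diff_distrib)
    also have "\<dots> = - (\<Sum>x\<in>S. ctr_diff h i (\<lambda>y. w y $ i) x * \<phi> x)"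
      unfolding 1 2 sum_subtractf[symmetric] sum_divide_distrib sum_negf[symmetric]
      by (simp add: ctr_diff_real left_diff_distrib minus_divide_left)
    finally show ?thesis .
  qed
  have "(\<Sum>x\<in>S. w x \<bullet> grid_grad h \<phi> x) = (\<Sum>i\<in>UNIV. \<Sum>x\<in>S. w x $ i * ctr_diff h i \<phi> x)"
    by (simp add: inner_vec_def grid_grad_def sum.swap[of _ S])
  also have "\<dots> = - (\<Sum>i\<in>UNIV. \<Sum>x\<in>S. ctr_diff h i (\<lambda>y. w y $ i) x * \<phi> x)"
    unfolding comp sum_negf ..
  also have "\<dots> = - (\<Sum>x\<in>S. grid_div h w x * \<phi> x)"
    by (simp add: grid_div_def sum_distrib_right sum.swap[of _ S])
  finally show ?thesis .
qed

lemma sum_inner_grid_grad_eq_0: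
  assumes "finite S" "\<And>x. x \<notin> S \<Longrightarrow> w x = 0" "\<And>x. x \<notin> S \<Longrightarrow> \<phi> x = 0"
    and "\<And>x. x \<in> S \<Longrightarrow> grid_div h w x = 0"
  shows "(\<Sum>x\<in>S. w x \<bullet> grid_grad h \<phi> x) = 0"
  using sum_inner_grid_grad[OF assms(1-3)] assms(4) by simp

lemma power2_norm_vec: "(norm y)\<^sup>2 = (\<Sum>k\<in>UNIV. (y $ k)\<^sup>2)" for y :: "real^'n"
  unfolding power2_norm_eq_inner inner_vec_def by (simp add: power2_eq_square)

lemma ctr_diff_diff: "ctr_diff h i (\<lambda>x. u x - v x) y = ctr_diff h i u y - ctr_diff h i v y"
  by (simp add: ctr_diff_def algebra_simps)

lemma snd_diff_diff: "snd_diff h i (\<lambda>x. u x - v x) y = snd_diff h i u y - snd_diff h i v y"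
  by (simp add: snd_diff_def algebra_simps)

lemma grid_div_diff: "grid_div h (\<lambda>x. u x - v x) y = grid_div h u y - grid_div h v y"
  by (simp add: grid_div_def ctr_diff_diff sum_subtractf)

lemma grid_grad_diff: "grid_grad h (\<lambda>x. u x - v x) y = grid_grad h u y - grid_grad h v y"
  by (simp add: grid_grad_def ctr_diff_diff vec_eq_iff)

section \<open>The discrete Helmholtz-Hodge decomposition\<close>

text \<open>Gram-Schmidt by induction on the index set: \<open>g k\<close> is replaced by its
  residual \<open>g'\<close> against the earlier family, and the component along \<open>g'\<close>
  is subtracted from the residual of \<open>u\<close>. The outcome is the orthogonal projection onto
  the span of a possibly dependent family.\<close>

lemma exists_orthogonal_residual:
  fixes g :: "'i \<Rightarrow> 'x \<Rightarrow> 'v::real_inner" and u :: "'x \<Rightarrow> 'v"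
  assumes X: "finite X" and K: "finite K"
  shows "\<exists>c. \<forall>i\<in>K. (\<Sum>x\<in>X. (u x - (\<Sum>j\<in>K. c j *\<^sub>R g j x)) \<bullet> g i x) = 0"
  using K
proof (induction K arbitrary: u rule: finite_induct)
  case empty
  show ?case by simp
next
  case (insert k K)
  obtain c where c: "\<And>i. i \<in> K \<Longrightarrow> (\<Sum>x\<in>X. (u x - (\<Sum>j\<in>K. c j *\<^sub>R g j x)) \<bullet> g i x) = 0"
    using insert.IH[of u] by blast
  obtain b where b: "\<And>i. i \<in> K \<Longrightarrow> (\<Sum>x\<in>X. (g k x - (\<Sum>j\<in>K. b j *\<^sub>R g j x)) \<bullet> g i x) = 0"
    using insert.IH[of "g k"] by blast
  define u' where "u' x = u x - (\<Sum>j\<in>K. c j *\<^sub>R g j x)" for x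
  define g' where "g' x = g k x - (\<Sum>j\<in>K. b j *\<^sub>R g j x)" for x
  define t where "t = (\<Sum>x\<in>X. u' x \<bullet> g' x) / (\<Sum>x\<in>X. g' x \<bullet> g' x)"
  define c' where "c' j = (if j = k then t else c j - t * b j)" for j
  have res: "u x - (\<Sum>j\<in>insert k K. c' j *\<^sub>R g j x) = u' x - t *\<^sub>R g' x" for x
  proof -
    have "(\<Sum>j\<in>K. c' j *\<^sub>R g j x) = (\<Sum>j\<in>K. c j *\<^sub>R g j x - t *\<^sub>R (b j *\<^sub>R g j x))"
      using insert.hyps by (intro sum.cong) (auto simp: c'_def algebra_simps)
    thus ?thesis using insert.hyps
      by (simp add: c'_def u'_def g'_def sum_subtractf scaleR_sum_right algebra_simps)
  qed
  have oK: "(\<Sum>x\<in>X. (u' x - t *\<^sub>R g' x) \<bullet> g i x) = 0" if "i \<in> K" for i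
  proof -
    have "(\<Sum>x\<in>X. (u' x - t *\<^sub>R g' x) \<bullet> g i x) = (\<Sum>x\<in>X. u' x \<bullet> g i x) - t * (\<Sum>x\<in>X. g' x \<bullet> g i x)"
      by (simp add: inner_diff_left sum_subtractf sum_distrib_left)
    thus ?thesis using b[OF that] c[OF that] by (simp add: u'_def g'_def)
  qed
  \<comment> \<open>If \<open>g k\<close> depends linearly on the others over \<open>X\<close>, then
    \<open>g'\<close> vanishes there and any coefficient serves.\<close>
  have og: "(\<Sum>x\<in>X. (u' x - t *\<^sub>R g' x) \<bullet> g' x) = 0"
  proof (cases "(\<Sum>x\<in>X. g' x \<bullet> g' x) = 0")
    case True
    hence "\<forall>x\<in>X. g' x = 0" using X by (subst (asm) sum_nonneg_eq_0_iff) auto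
    thus ?thesis by simp
  next
    case False
    have "(\<Sum>x\<in>X. (u' x - t *\<^sub>R g' x) \<bullet> g' x) = (\<Sum>x\<in>X. u' x \<bullet> g' x) - t * (\<Sum>x\<in>X. g' x \<bullet> g' x)"
      by (simp add: inner_diff_left sum_subtractf sum_distrib_left)
    thus ?thesis using False by (simp add: t_def)
  qed
  have "(\<Sum>x\<in>X. (u' x - t *\<^sub>R g' x) \<bullet> g k x)
      = (\<Sum>x\<in>X. (u' x - t *\<^sub>R g' x) \<bullet> g' x + (\<Sum>j\<in>K. b j * ((u' x - t *\<^sub>R g' x) \<bullet> g j x)))"
    by (intro sum.cong) (auto simp: g'_def inner_diff_right inner_sum_right)
  also have "\<dots> = (\<Sum>j\<in>K. b j * (\<Sum>x\<in>X. (u' x - t *\<^sub>R g' x) \<bullet> g j x))"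
    by (simp only: sum.distrib og sum_distrib_left) (simp add: sum.swap[of _ K])
  also have "\<dots> = 0" using oK by simp
  finally have "\<forall>i\<in>insert k K. (\<Sum>x\<in>X. (u x - (\<Sum>j\<in>insert k K. c' j *\<^sub>R g j x)) \<bullet> g i x) = 0"
    unfolding res using oK by auto
  thus ?case by blast
qed

text \<open>On an inner point the central differences only compare neighbours of equal parity, so the
  means over the parity classes can be adjusted without changing the gradient.\<close>

lemma helmholtz_hodge_exists:
  assumes bd: "bounded \<Omega>" and h: "0 < h"
  shows "\<exists>w \<phi>. helmholtz_hodge \<Omega> h u w \<phi>"
proof -
  define S where "S = grid_domain \<Omega> h"
  define I where "I = inner_grid \<Omega> h"
  have S: "finite S" unfolding S_def by (rule finite_grid_domain[OF bd h])
  have IS: "I \<subseteq> S" by (auto simp: I_def S_def)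
  have fI: "finite I" using S IS finite_subset by blast
  define \<delta> where "\<delta> y x = (if x = y then 1 else 0 :: real)" for x y :: "real^3"
  \<comment> \<open>The unit masses \<open>\<delta> y\<close> span all grid functions, so this
    projects \<open>u\<close>, over the inner points, onto the space of all discrete
    gradients.\<close>
  obtain c where c: "\<And>y. y \<in> S \<Longrightarrow>
      (\<Sum>x\<in>I. (u x - (\<Sum>j\<in>S. c j *\<^sub>R grid_grad h (\<delta> j) x)) \<bullet> grid_grad h (\<delta> y) x) = 0"
    using exists_orthogonal_residual[OF fI S, of u "\<lambda>j. grid_grad h (\<delta> j)"] by blast
  define \<phi>0 where "\<phi>0 x = (if x \<in> S then c x else 0)" for x
  have \<phi>0: "\<phi>0 x = (\<Sum>j\<in>S. c j * \<delta> j x)" for x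
    using S by (simp add: \<phi>0_def \<delta>_def if_distrib[of "\<lambda>t. _ * t"] cong: if_cong)
  have grad0: "grid_grad h \<phi>0 x = (\<Sum>j\<in>S. c j *\<^sub>R grid_grad h (\<delta> j) x)" for x
    by (simp add: vec_eq_iff grid_grad_def ctr_diff_def \<phi>0 sum_subtractf[symmetric] sum_distrib_left algebra_simps)
  \<comment> \<open>The floor makes parity a total function on space; at grid points the quotient by
    \<open>h\<close> is an integer and the label of the parity class results.\<close>
  define par where "par x i = even \<lfloor>x $ i / h\<rfloor>" for x :: "real^3" and i :: 3
  have par_class: "par x = p" if x: "x \<in> parity_class h p" for x p
  proof
    fix i
    obtain z where z: "x = scaled_point h z" "\<forall>i. even (z $ i) \<longleftrightarrow> p i"
      using x unfolding parity_class_def by blast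
    have "x $ i / h = of_int (z $ i)" using h by (simp add: z(1) scaled_point_def)
    thus "par x i = p i" using z(2) by (simp add: par_def)
  qed
  have par_step: "par (x + step h i) = par (x - step h i)" for x i
  proof
    fix k
    have "(x + step h i) $ k / h = (x - step h i) $ k / h + of_int (if k = i then 2 else 0)"
      using h by (simp add: axis_def field_simps)
    hence "\<lfloor>(x + step h i) $ k / h\<rfloor> = \<lfloor>(x - step h i) $ k / h\<rfloor> + (if k = i then 2 else 0)"
      by (metis floor_add_int)
    thus "par (x + step h i) k = par (x - step h i) k" by (simp add: par_def)
  qed
  \<comment> \<open>The mean of \<open>\<phi>0\<close> over a core class, subtracted below at all
    grid points of that parity. An empty class gets 0 by division by zero, and its mean condition is
    an empty sum.\<close>
  define m where "m p = (\<Sum>x\<in>core_class \<Omega> h p. c x) / real (card (core_class \<Omega> h p))" for p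
  define \<mu> where "\<mu> x = (if x \<in> S then m (par x) else 0)" for x
  define \<phi> where "\<phi> x = \<phi>0 x - \<mu> x" for x
  define w where "w x = (if x \<in> I then u x - grid_grad h \<phi>0 x else 0)" for x
  have grad\<mu>: "grid_grad h \<mu> x = 0" if "x \<in> I" for x
    using inner_grid_neighbours[of x \<Omega> h] that
    by (simp add: vec_eq_iff grid_grad_def ctr_diff_def \<mu>_def par_step S_def I_def)
  have grad: "grid_grad h \<phi> x = grid_grad h \<phi>0 x" if "x \<in> I" for x
    using grad\<mu>[OF that] unfolding \<phi>_def grid_grad_diff by simp
  have w0: "w x = 0" if "x \<notin> S" for x using that IS by (auto simp: w_def)
  have div: "grid_div h w y = 0" if y: "y \<in> S" for y
  proof -
    \<comment> \<open>By summation by parts, orthogonality to the gradient of the unit mass at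
      \<open>y\<close> says that the divergence vanishes at \<open>y\<close>. This includes boundary
      points \<open>y\<close>.\<close>
    have "(\<Sum>x\<in>S. w x \<bullet> grid_grad h (\<delta> y) x) = (\<Sum>x\<in>I. w x \<bullet> grid_grad h (\<delta> y) x)"
      using S IS by (intro sum.mono_neutral_right) (auto simp: w_def)
    also have "\<dots> = 0"
      using c[OF y] by (simp add: w_def grad0)
    finally have "(\<Sum>x\<in>S. grid_div h w x * \<delta> y x) = 0"
      using sum_inner_grid_grad[OF S, of w "\<delta> y" h] w0 y by (force simp: \<delta>_def)
    thus ?thesis using S y by (simp add: \<delta>_def if_distrib[of "\<lambda>t. _ * t"] cong: if_cong)
  qed
  have mean: "(\<Sum>x\<in>core_class \<Omega> h p. \<phi> x) = 0" for p
  proof -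
    have sub: "core_class \<Omega> h p \<subseteq> S" by (auto simp: grid_core_def S_def)
    have fin: "finite (core_class \<Omega> h p)" using sub S finite_subset by blast
    have "(\<Sum>x\<in>core_class \<Omega> h p. \<phi> x) = (\<Sum>x\<in>core_class \<Omega> h p. c x - m p)"
      by (intro sum.cong refl) (use sub par_class in \<open>auto simp: \<phi>_def \<phi>0_def \<mu>_def\<close>)
    also have "\<dots> = 0"
      using fin by (cases "core_class \<Omega> h p = {}") (auto simp: sum_subtractf m_def)
    finally show ?thesis .
  qed
  have "helmholtz_hodge \<Omega> h u w \<phi>"
    unfolding helmholtz_hodge_def
  proof (intro conjI ballI allI)
    show "grid_fun \<Omega> h w" using w0 by (simp add: grid_fun_def S_def)
    show "grid_fun \<Omega> h \<phi>" by (simp add: grid_fun_def \<phi>_def \<phi>0_def \<mu>_def S_def)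
    show "grid_div h w x = 0" if "x \<in> grid_domain \<Omega> h" for x using div that by (simp add: S_def)
    show "w x + grid_grad h \<phi> x = u x" if "x \<in> inner_grid \<Omega> h" for x
      using grad[of x] that by (simp add: w_def I_def)
    show "w x = 0" if "x \<in> bdry \<Omega> h" for x using that by (simp add: w_def I_def)
  qed (rule mean)
  thus ?thesis by blast
qed

text \<open>The difference of two decompositions decomposes the difference, and its solenoidal part is
  orthogonal to the gradient part.\<close>

lemma helmholtz_hodge_diff_energy:
  assumes bd: "bounded \<Omega>" and h: "0 < h"
    and H: "helmholtz_hodge \<Omega> h u1 w1 \<phi>1" "helmholtz_hodge \<Omega> h u2 w2 \<phi>2"
  shows "(\<Sum>x\<in>grid_domain \<Omega> h. (norm (w1 x - w2 x))\<^sup>2)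
      = (\<Sum>x\<in>grid_domain \<Omega> h. (w1 x - w2 x) \<bullet> (u1 x - u2 x))"
proof -
  let ?w = "\<lambda>x. w1 x - w2 x" and ?\<phi> = "\<lambda>x. \<phi>1 x - \<phi>2 x"
  have "(\<Sum>x\<in>grid_domain \<Omega> h. ?w x \<bullet> grid_grad h ?\<phi> x) = 0"
    using H by (intro sum_inner_grid_grad_eq_0 finite_grid_domain[OF bd h])
      (auto simp: helmholtz_hodge_def grid_fun_def grid_div_diff)
  moreover have "(\<Sum>x\<in>grid_domain \<Omega> h. (norm (?w x))\<^sup>2 + ?w x \<bullet> grid_grad h ?\<phi> x)
      = (\<Sum>x\<in>grid_domain \<Omega> h. ?w x \<bullet> (u1 x - u2 x))"
  proof (intro sum.cong refl)
    fix x assume x: "x \<in> grid_domain \<Omega> h"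
    show "(norm (?w x))\<^sup>2 + ?w x \<bullet> grid_grad h ?\<phi> x = ?w x \<bullet> (u1 x - u2 x)"
    proof (cases "x \<in> bdry \<Omega> h")
      case True
      thus ?thesis using H by (auto simp: helmholtz_hodge_def)
    next
      case False
      hence "u1 x - u2 x = ?w x + grid_grad h ?\<phi> x"
        using H x by (auto simp: helmholtz_hodge_def grid_grad_diff algebra_simps)
      thus ?thesis by (simp add: inner_add_right dot_square_norm)
    qed
  qed
  ultimately show ?thesis by (simp add: sum.distrib)
qed

text \<open>The description operator needs existence and uniqueness. For uniqueness, the energy
  identity for two decompositions of the same field has right-hand side 0.\<close>

lemma helmholtz_proj_hodge:
  assumes bd: "bounded \<Omega>" and h: "0 < h"
  shows "\<exists>\<phi>. helmholtz_hodge \<Omega> h u (helmholtz_proj \<Omega> h u) \<phi>"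
proof -
  obtain w \<phi> where H: "helmholtz_hodge \<Omega> h u w \<phi>" using helmholtz_hodge_exists[OF bd h] by blast
  have "w' = w" if H': "helmholtz_hodge \<Omega> h u w' \<phi>'" for w' \<phi>'
  proof
    fix x
    have "(\<Sum>x\<in>grid_domain \<Omega> h. (norm (w' x - w x))\<^sup>2) = 0"
      using helmholtz_hodge_diff_energy[OF bd h H' H] by simp
    hence "\<forall>x\<in>grid_domain \<Omega> h. w' x = w x"
      by (subst (asm) sum_nonneg_eq_0_iff) (auto simp: finite_grid_domain[OF bd h])
    moreover have "\<forall>x. x \<notin> grid_domain \<Omega> h \<longrightarrow> w' x = w x"
      using H H' by (simp add: helmholtz_hodge_def grid_fun_def)
    ultimately show "w' x = w x" by blast
  qed
  hence "\<exists>!w. \<exists>\<phi>. helmholtz_hodge \<Omega> h u w \<phi>" using H by blast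
  thus ?thesis unfolding helmholtz_proj_def by (rule theI')
qed

section \<open>The convection term\<close>

text \<open>The scheme's convection term, without its factor -1/2, once the shifts have been moved
  onto the test field: \<open>w\<close> transports, \<open>c\<close> is differentiated,
  \<open>b\<close> tests.\<close>

definition convection_form ::
  "(real^3) set \<Rightarrow> real \<Rightarrow> (real^3 \<Rightarrow> real^3) \<Rightarrow> (real^3 \<Rightarrow> real^3) \<Rightarrow> (real^3 \<Rightarrow> real^3) \<Rightarrow> real" where
  "convection_form S h w c b = (\<Sum>x\<in>S. \<Sum>j\<in>UNIV.
     w x $ j * (ctr_diff h j c x \<bullet> (b (x + step h j) + b (x - step h j))))"

lemma convection_form_eq:
  assumes S: "finite S" and w: "\<And>x. x \<notin> S \<Longrightarrow> w x = 0" and b: "\<And>x. x \<notin> S \<Longrightarrow> b x = 0"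
  shows "(\<Sum>x\<in>S. b x \<bullet> (\<Sum>j\<in>UNIV.
      (w (x - step h j) $ j) *\<^sub>R ctr_diff h j c (x - step h j)
      + (w (x + step h j) $ j) *\<^sub>R ctr_diff h j c (x + step h j))) = convection_form S h w c b"
proof -
  define q where "q j x = (w x $ j) *\<^sub>R ctr_diff h j c x" for j x
  have q0: "q j x = 0" if "x \<notin> S" for j x using w[OF that] by (simp add: q_def)
  have p: "(\<Sum>x\<in>S. b x \<bullet> q j (x + step h j)) = (\<Sum>x\<in>S. b (x - step h j) \<bullet> q j x)" for j
    using b q0 by (intro sum_inner_shift[OF S])
  have m: "(\<Sum>x\<in>S. b x \<bullet> q j (x - step h j)) = (\<Sum>x\<in>S. b (x + step h j) \<bullet> q j x)" for j
    using sum_inner_shift[OF S, of b "q j" "- step h j"] b q0 by simp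
  have "(\<Sum>x\<in>S. b x \<bullet> (\<Sum>j\<in>UNIV. q j (x - step h j) + q j (x + step h j)))
      = (\<Sum>j\<in>UNIV. (\<Sum>x\<in>S. b x \<bullet> q j (x - step h j)) + (\<Sum>x\<in>S. b x \<bullet> q j (x + step h j)))"
    by (simp add: inner_sum_right inner_add_right sum.distrib sum.swap[of _ S])
  also have "\<dots> = convection_form S h w c b"
    unfolding p m convection_form_def sum.distrib[symmetric]
    by (subst sum.swap, intro sum.cong refl)
      (simp add: q_def inner_add_right inner_commute distrib_left add.commute)
  finally show ?thesis unfolding q_def .
qed

text \<open>By the exact product rule for central differences, the two forms add up to twice the
  pairing of \<open>w\<close> with the gradient of the pointwise product of \<open>c\<close> and
  \<open>b\<close>, and a divergence-free \<open>w\<close> is orthogonal to gradients.\<close>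

lemma convection_form_antisym:
  assumes S: "finite S" and w: "\<And>x. x \<notin> S \<Longrightarrow> w x = 0" and b: "\<And>x. x \<notin> S \<Longrightarrow> b x = 0"
    and div: "\<And>x. x \<in> S \<Longrightarrow> grid_div h w x = 0"
  shows "convection_form S h w c b = - convection_form S h w b c"
proof -
  have "convection_form S h w c b + convection_form S h w b c
      = (\<Sum>x\<in>S. 2 * (w x \<bullet> grid_grad h (\<lambda>y. c y \<bullet> b y) x))"
    unfolding convection_form_def sum.distrib[symmetric]
    by (intro sum.cong refl)
      (simp add: inner_vec_def[of "w _"] grid_grad_def sum_distrib_left sum.distrib[symmetric]
        ctr_diff_def inner_add_right inner_diff_left inner_commute algebra_simps)
  also have "\<dots> = 2 * (\<Sum>x\<in>S. w x \<bullet> grid_grad h (\<lambda>y. c y \<bullet> b y) x)"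
    by (simp add: sum_distrib_left)
  also have "\<dots> = 0"
    using sum_inner_grid_grad_eq_0[OF S w _ div, of "\<lambda>y. c y \<bullet> b y"] b by simp
  finally show ?thesis by simp
qed

text \<open>The field \<open>v\<close> enters undifferentiated, so its pointwise bound suffices;
  Young's inequality in the form 2pq \<le> p^2 + q^2 does the rest.\<close>

lemma convection_form_le:
  assumes v: "\<And>x. norm (v x) \<le> \<beta>"
  shows "convection_form S h w b v \<le>
    (\<Sum>x\<in>S. \<beta>\<^sup>2 * (norm (w x))\<^sup>2 + (\<Sum>j\<in>UNIV. (norm (ctr_diff h j b x))\<^sup>2))"
proof -
  have \<beta>: "0 \<le> \<beta>" using v[of 0] norm_ge_zero order_trans by blast
  have pt: "w x $ j * (ctr_diff h j b x \<bullet> (v (x + step h j) + v (x - step h j)))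
      \<le> \<beta>\<^sup>2 * (w x $ j)\<^sup>2 + (norm (ctr_diff h j b x))\<^sup>2" for x j
  proof -
    let ?d = "norm (ctr_diff h j b x)"
    have "norm (v (x + step h j) + v (x - step h j)) \<le> 2 * \<beta>"
      using v[of "x + step h j"] v[of "x - step h j"] norm_triangle_ineq[of "v (x + step h j)" "v (x - step h j)"]
      by linarith
    hence "\<bar>ctr_diff h j b x \<bullet> (v (x + step h j) + v (x - step h j))\<bar> \<le> ?d * (2 * \<beta>)"
      by (meson Cauchy_Schwarz_ineq2 mult_left_mono norm_ge_zero order_trans)
    hence "\<bar>w x $ j\<bar> * \<bar>ctr_diff h j b x \<bullet> (v (x + step h j) + v (x - step h j))\<bar> \<le> \<bar>w x $ j\<bar> * (?d * (2 * \<beta>))"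
      by (intro mult_left_mono) auto
    also have "\<dots> \<le> \<beta>\<^sup>2 * (w x $ j)\<^sup>2 + ?d\<^sup>2"
      using zero_le_power2[of "\<beta> * \<bar>w x $ j\<bar> - ?d"]
      by (simp add: power2_diff power_mult_distrib algebra_simps)
    finally show ?thesis by (simp add: abs_mult[symmetric])
  qed
  show ?thesis
    unfolding convection_form_def
  proof (intro sum_mono)
    fix x
    have "(\<Sum>j\<in>UNIV. w x $ j * (ctr_diff h j b x \<bullet> (v (x + step h j) + v (x - step h j))))
      \<le> (\<Sum>j\<in>UNIV. \<beta>\<^sup>2 * (w x $ j)\<^sup>2 + (norm (ctr_diff h j b x))\<^sup>2)"
      by (intro sum_mono pt)
    also have "\<dots> = \<beta>\<^sup>2 * (norm (w x))\<^sup>2 + (\<Sum>j\<in>UNIV. (norm (ctr_diff h j b x))\<^sup>2)"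
      by (simp add: sum.distrib sum_distrib_left power2_norm_vec)
    finally show "(\<Sum>j\<in>UNIV. w x $ j * (ctr_diff h j b x \<bullet> (v (x + step h j) + v (x - step h j))))
      \<le> \<beta>\<^sup>2 * (norm (w x))\<^sup>2 + (\<Sum>j\<in>UNIV. (norm (ctr_diff h j b x))\<^sup>2)" .
  qed
qed

section \<open>Viscous energy\<close>

text \<open>Over the whole group this would be an equality. The left sum omits the differences based
  outside \<open>S\<close> that end in \<open>S\<close>, hence the inequality.\<close>

lemma sum_shift_diff_le:
  fixes b :: "real^3 \<Rightarrow> 'b::real_inner"
  assumes S: "finite S" and b: "\<And>x. x \<notin> S \<Longrightarrow> b x = 0"
  shows "(\<Sum>x\<in>S. (norm (b (x + a) - b x))\<^sup>2) \<le> - (\<Sum>x\<in>S. b x \<bullet> (b (x + a) + b (x - a) - 2 *\<^sub>R b x))"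
proof -
  have le: "(\<Sum>x\<in>S. (norm (b (x + a)))\<^sup>2) \<le> (\<Sum>x\<in>S. (norm (b x))\<^sup>2)"
    using b by (intro sum_shift_le[OF S]) auto
  have eq: "(\<Sum>x\<in>S. b x \<bullet> b (x + a)) = (\<Sum>x\<in>S. b x \<bullet> b (x - a))"
    using sum_inner_shift[OF S, of b b a] b by (simp add: inner_commute)
  have "(\<Sum>x\<in>S. (norm (b (x + a) - b x))\<^sup>2)
      = (\<Sum>x\<in>S. (norm (b (x + a)))\<^sup>2) + (\<Sum>x\<in>S. (norm (b x))\<^sup>2) - 2 * (\<Sum>x\<in>S. b x \<bullet> b (x + a))"
    by (simp add: power2_norm_eq_inner inner_diff_left inner_diff_right inner_commute
        sum.distrib sum_subtractf sum_distrib_left algebra_simps)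
  moreover have "(\<Sum>x\<in>S. b x \<bullet> (b (x + a) + b (x - a) - 2 *\<^sub>R b x))
      = (\<Sum>x\<in>S. b x \<bullet> b (x + a)) + (\<Sum>x\<in>S. b x \<bullet> b (x - a)) - 2 * (\<Sum>x\<in>S. (norm (b x))\<^sup>2)"
    by (simp add: power2_norm_eq_inner inner_diff_right inner_add_right
        sum.distrib sum_subtractf sum_distrib_left)
  ultimately show ?thesis using le eq by simp
qed

lemma power2_norm_divideR: "(norm (x /\<^sub>R c))\<^sup>2 = (norm x)\<^sup>2 / c\<^sup>2"
  by (simp add: power_mult_distrib power_inverse divide_inverse_commute)

lemma sum_fwd_diff_le:
  fixes b :: "real^3 \<Rightarrow> 'b::real_inner"
  assumes S: "finite S" and b: "\<And>x. x \<notin> S \<Longrightarrow> b x = 0"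
  shows "(\<Sum>x\<in>S. (norm (fwd_diff h j b x))\<^sup>2) \<le> - (\<Sum>x\<in>S. b x \<bullet> snd_diff h j b x)"
proof -
  have "(\<Sum>x\<in>S. (norm (fwd_diff h j b x))\<^sup>2) = (\<Sum>x\<in>S. (norm (b (x + step h j) - b x))\<^sup>2) / h\<^sup>2"
    by (simp only: fwd_diff_def power2_norm_divideR sum_divide_distrib)
  also have "\<dots> \<le> (- (\<Sum>x\<in>S. b x \<bullet> (b (x + step h j) + b (x - step h j) - 2 *\<^sub>R b x))) / h\<^sup>2"
    using b by (intro divide_right_mono sum_shift_diff_le[OF S]) auto
  also have "\<dots> = - (\<Sum>x\<in>S. b x \<bullet> snd_diff h j b x)"
    by (simp add: snd_diff_def sum_distrib_left divide_inverse mult.commute)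
  finally show ?thesis .
qed

text \<open>A central difference is the mean of the forward and the backward one, so by the
  parallelogram law its square is at most the mean of their squares, each of which sums to at most
  the viscous energy.\<close>

lemma sum_ctr_diff_le:
  fixes b :: "real^3 \<Rightarrow> 'b::real_inner"
  assumes S: "finite S" and b: "\<And>x. x \<notin> S \<Longrightarrow> b x = 0"
  shows "(\<Sum>x\<in>S. (norm (ctr_diff h j b x))\<^sup>2) \<le> - (\<Sum>x\<in>S. b x \<bullet> snd_diff h j b x)"
proof -
  let ?a = "step h j"
  let ?G = "- (\<Sum>x\<in>S. b x \<bullet> (b (x + ?a) + b (x - ?a) - 2 *\<^sub>R b x))"
  have 1: "(\<Sum>x\<in>S. (norm (b (x + ?a) - b x))\<^sup>2) \<le> ?G"
    using b by (intro sum_shift_diff_le[OF S])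
  have 2: "(\<Sum>x\<in>S. (norm (b (x - ?a) - b x))\<^sup>2) \<le> ?G"
    using sum_shift_diff_le[OF S, of b "- ?a"] b by (simp add: add.commute)
  have pt: "(norm (b (x + ?a) - b (x - ?a)))\<^sup>2
      \<le> 2 * (norm (b (x + ?a) - b x))\<^sup>2 + 2 * (norm (b (x - ?a) - b x))\<^sup>2" for x
  proof -
    let ?p = "b (x + ?a) - b x" and ?q = "b (x - ?a) - b x"
    have "(norm (?p - ?q))\<^sup>2 + (norm (?p + ?q))\<^sup>2 = 2 * (norm ?p)\<^sup>2 + 2 * (norm ?q)\<^sup>2"
      by (simp only: power2_norm_eq_inner inner_diff_left inner_diff_right inner_add_left inner_add_right)
        (simp add: inner_commute)
    moreover have "?p - ?q = b (x + ?a) - b (x - ?a)" by simp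
    ultimately show ?thesis by (metis le_add_same_cancel1 zero_le_power2)
  qed
  have "(\<Sum>x\<in>S. (norm (ctr_diff h j b x))\<^sup>2) = (\<Sum>x\<in>S. (norm (b (x + ?a) - b (x - ?a)))\<^sup>2) / (2*h)\<^sup>2"
    by (simp only: ctr_diff_def power2_norm_divideR sum_divide_distrib)
  also have "\<dots> \<le> (\<Sum>x\<in>S. 2 * (norm (b (x + ?a) - b x))\<^sup>2 + 2 * (norm (b (x - ?a) - b x))\<^sup>2) / (2*h)\<^sup>2"
    by (intro divide_right_mono sum_mono pt) auto
  also have "\<dots> \<le> (4 * ?G) / (2*h)\<^sup>2"
    using 1 2 by (intro divide_right_mono) (auto simp: sum.distrib sum_distrib_left[symmetric])
  also have "\<dots> = ?G / h\<^sup>2" by (simp add: power_mult_distrib)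
  also have "\<dots> = - (\<Sum>x\<in>S. b x \<bullet> snd_diff h j b x)"
    by (simp add: snd_diff_def sum_distrib_left divide_inverse mult.commute)
  finally show ?thesis .
qed

text \<open>The scalar Poincare inequality is applied to each component of \<open>b\<close> in each
  direction; the factor 3 counts the directions.\<close>

lemma poincare_energy:
  fixes b :: "real^3 \<Rightarrow> real^3"
  assumes bd: "bounded \<Omega>" and h: "0 < h" and P: "discrete_poincare \<Omega> h A"
    and b: "grid_fun \<Omega> h b" "\<And>x. x \<in> bdry \<Omega> h \<Longrightarrow> b x = 0"
  shows "3 * (\<Sum>x\<in>grid_domain \<Omega> h. (norm (b x))\<^sup>2)
    \<le> A\<^sup>2 * - (\<Sum>x\<in>grid_domain \<Omega> h. b x \<bullet> (\<Sum>j\<in>UNIV. snd_diff h j b x))"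
proof -
  define S where "S = grid_domain \<Omega> h"
  have S: "finite S" unfolding S_def by (rule finite_grid_domain[OF bd h])
  have b0: "b x = 0" if "x \<notin> S" for x using b(1) that by (simp add: grid_fun_def S_def)
  have one: "(\<Sum>x\<in>S. (norm (b x))\<^sup>2) \<le> A\<^sup>2 * - (\<Sum>x\<in>S. b x \<bullet> snd_diff h j b x)" for j
  proof -
    have comp: "(\<Sum>x\<in>S. (b x $ k)\<^sup>2) \<le> A\<^sup>2 * (\<Sum>x\<in>S. (fwd_diff h j b x $ k)\<^sup>2)" for k
    proof -
      have "(\<Sum>x\<in>S. (b x $ k)\<^sup>2) \<le> A\<^sup>2 * (\<Sum>x\<in>inner_grid \<Omega> h. (fwd_diff h j (\<lambda>x. b x $ k) x)\<^sup>2)"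
        using P[unfolded discrete_poincare_def, rule_format, of "\<lambda>x. b x $ k" j] b
        by (simp add: grid_fun_def S_def)
      also have "\<dots> \<le> A\<^sup>2 * (\<Sum>x\<in>S. (fwd_diff h j (\<lambda>x. b x $ k) x)\<^sup>2)"
        using S by (intro mult_left_mono sum_mono2) (auto simp: S_def)
      finally show ?thesis by (simp add: fwd_diff_def)
    qed
    have "(\<Sum>x\<in>S. (norm (b x))\<^sup>2) = (\<Sum>k\<in>UNIV. \<Sum>x\<in>S. (b x $ k)\<^sup>2)"
      unfolding power2_norm_vec by (rule sum.swap)
    also have "\<dots> \<le> (\<Sum>k\<in>UNIV. A\<^sup>2 * (\<Sum>x\<in>S. (fwd_diff h j b x $ k)\<^sup>2))"
      by (intro sum_mono comp)
    also have "\<dots> = A\<^sup>2 * (\<Sum>x\<in>S. (norm (fwd_diff h j b x))\<^sup>2)"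
      unfolding power2_norm_vec sum_distrib_left[symmetric] by (subst sum.swap) simp
    also have "\<dots> \<le> A\<^sup>2 * - (\<Sum>x\<in>S. b x \<bullet> snd_diff h j b x)"
      using b0 by (intro mult_left_mono sum_fwd_diff_le[OF S]) auto
    finally show ?thesis .
  qed
  have "3 * (\<Sum>x\<in>S. (norm (b x))\<^sup>2) = (\<Sum>j\<in>(UNIV::3 set). \<Sum>x\<in>S. (norm (b x))\<^sup>2)" by simp
  also have "\<dots> \<le> (\<Sum>j\<in>(UNIV::3 set). A\<^sup>2 * - (\<Sum>x\<in>S. b x \<bullet> snd_diff h j b x))"
    by (intro sum_mono one)
  also have "\<dots> = A\<^sup>2 * - (\<Sum>x\<in>S. b x \<bullet> (\<Sum>j\<in>UNIV. snd_diff h j b x))"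
    unfolding sum_distrib_left[symmetric] sum_negf inner_sum_right by (subst sum.swap) simp
  finally show ?thesis unfolding S_def .
qed

section \<open>One-step contraction and exponential decay\<close>

text \<open>An implicit step damps only by a linear factor in s = A^-2 \<tau>. A factor 1 + s would
  stay below exp s; the three directions of the Poincare inequality supply 1 + 3s, which leaves room
  for the convective growth s/16.\<close>

lemma exp_mult_le:
  fixes s :: real
  assumes "0 \<le> s" "s \<le> 1"
  shows "exp s * (1 + s / 16) \<le> 1 + 3 * s"
proof -
  have ss: "s * s \<le> s" using assms by (simp add: mult_left_le)
  have "exp s \<le> 1 + 2 * s" using exp_bound[OF assms] ss by (simp add: power2_eq_square)
  hence "exp s * (1 + s / 16) \<le> (1 + 2 * s) * (1 + s / 16)" using assms by (intro mult_right_mono) auto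
  also have "\<dots> \<le> 1 + 3 * s" using ss assms by (simp add: algebra_simps)
  finally show ?thesis .
qed

text \<open>Testing the difference of the two schemes with the difference \<open>b\<close> of the new iterates: the
  transport of \<open>b\<close> drops out, and antisymmetry moves the difference quotient in the other
  convection term from the small solution \<open>ut\<close> to \<open>b\<close>, where the viscous term absorbs it.\<close>

lemma discrete_NS_contraction_step:
  assumes bd: "bounded \<Omega>" and h: "0 < h" and \<tau>: "0 < \<tau>" "\<tau> \<le> 1" and A: "1 \<le> A"
    and P: "discrete_poincare \<Omega> h A"
    and U: "discrete_NS \<Omega> h \<tau> f ut u" and W: "discrete_NS \<Omega> h \<tau> f wt w"
    and small: "\<And>x. x \<in> grid_domain \<Omega> h \<Longrightarrow> norm (ut (Suc n) x) \<le> inverse A / 4"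
  shows "(\<Sum>x\<in>grid_domain \<Omega> h. (norm (wt (Suc n) x - ut (Suc n) x))\<^sup>2)
    \<le> exp (- (1 / A\<^sup>2 * \<tau>)) * (\<Sum>x\<in>grid_domain \<Omega> h. (norm (wt n x - ut n x))\<^sup>2)"
proof -
  define S where "S = grid_domain \<Omega> h"
  define b where "b x = wt (Suc n) x - ut (Suc n) x" for x
  define E where "E x = w n x - u n x" for x
  define v where "v = ut (Suc n)"
  define \<beta> where "\<beta> = inverse A / 4"
  have S: "finite S" unfolding S_def by (rule finite_grid_domain[OF bd h])
  obtain \<phi>w where Hw: "helmholtz_hodge \<Omega> h (wt n) (w n) \<phi>w"
    using helmholtz_proj_hodge[OF bd h, of "wt n"] W by (auto simp: discrete_NS_def)
  obtain \<phi>u where Hu: "helmholtz_hodge \<Omega> h (ut n) (u n) \<phi>u"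
    using helmholtz_proj_hodge[OF bd h, of "ut n"] U by (auto simp: discrete_NS_def)
  have b0: "b x = 0" if "x \<notin> S" for x
    using U W that by (simp add: discrete_NS_def grid_fun_def b_def S_def)
  have bb: "b x = 0" if "x \<in> bdry \<Omega> h" for x
    using U W that by (simp add: discrete_NS_def b_def)
  have w0: "w n x = 0" and E0: "E x = 0" if "x \<notin> S" for x
    using Hu Hw that by (simp_all add: helmholtz_hodge_def grid_fun_def E_def S_def)
  have divw: "grid_div h (w n) x = 0" and divE: "grid_div h E x = 0" if "x \<in> S" for x
    using Hu Hw that unfolding E_def by (simp_all add: helmholtz_hodge_def grid_div_diff S_def)
  have v: "norm (v x) \<le> \<beta>" for x
  proof (cases "x \<in> S")
    case True
    thus ?thesis using small by (simp add: v_def \<beta>_def S_def)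
  next
    case False
    hence "v x = 0" using U by (simp add: v_def discrete_NS_def grid_fun_def S_def)
    thus ?thesis using A by (simp add: \<beta>_def)
  qed
  define e where "e x = wt n x - ut n x" for x
  define nb where "nb = (\<Sum>x\<in>S. (norm (b x))\<^sup>2)"
  define nE where "nE = (\<Sum>x\<in>S. (norm (E x))\<^sup>2)"
  define ne where "ne = (\<Sum>x\<in>S. (norm (e x))\<^sup>2)"
  define G where "G = - (\<Sum>x\<in>S. b x \<bullet> (\<Sum>j\<in>UNIV. snd_diff h j b x))"
  have young: "y \<bullet> z \<le> ((norm y)\<^sup>2 + (norm z)\<^sup>2) / 2" for y z :: "real^3"
    using zero_le_power2[of "norm (y - z)"]
    unfolding power2_norm_eq_inner by (simp add: inner_diff_left inner_diff_right inner_commute)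
  \<comment> \<open>The projection is nonexpansive: the energy identity and Young's inequality give
    nE \<le> (nE + ne)/2.\<close>
  have nEe: "nE \<le> ne"
  proof -
    have "nE = (\<Sum>x\<in>S. E x \<bullet> e x)"
      using helmholtz_hodge_diff_energy[OF bd h Hw Hu] by (simp add: nE_def E_def e_def S_def)
    also have "\<dots> \<le> (\<Sum>x\<in>S. ((norm (E x))\<^sup>2 + (norm (e x))\<^sup>2) / 2)" by (intro sum_mono young)
    also have "\<dots> = (nE + ne) / 2" by (simp add: nE_def ne_def sum.distrib sum_divide_distrib[symmetric])
    finally show ?thesis by simp
  qed
  have poinc: "3 * nb \<le> A\<^sup>2 * G"
    unfolding nb_def G_def S_def
    by (rule poincare_energy[OF bd h P _ bb]) (use b0 in \<open>simp_all add: grid_fun_def S_def\<close>)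
  define C where "C a c x = (\<Sum>j\<in>UNIV.
      (a (x - step h j) $ j) *\<^sub>R ctr_diff h j c (x - step h j)
      + (a (x + step h j) $ j) *\<^sub>R ctr_diff h j c (x + step h j))" for a c :: "real^3 \<Rightarrow> real^3" and x
  \<comment> \<open>The mixed term is chosen so that \<open>b\<close> is carried by a
    divergence-free field and the small field \<open>v\<close> is paired with
    \<open>E\<close>.\<close>
  have split: "C (w n) (wt (Suc n)) x - C (u n) v x = C (w n) b x + C E v x" for x
    unfolding C_def sum_subtractf[symmetric] sum.distrib[symmetric] b_def ctr_diff_diff E_def v_def
    by (intro sum.cong refl) (simp add: algebra_simps)
  have pt: "(b x - E x) /\<^sub>R \<tau> = - ((1/2) *\<^sub>R (C (w n) b x + C E v x)) + (\<Sum>j\<in>UNIV. snd_diff h j b x)"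
    if x: "x \<in> inner_grid \<Omega> h" for x
  proof -
    have ew: "(wt (Suc n) x - w n x) /\<^sub>R \<tau> = - ((1/2) *\<^sub>R C (w n) (wt (Suc n)) x)
        + (\<Sum>j\<in>UNIV. snd_diff h j (wt (Suc n)) x) + mean_force h \<tau> f n x"
      using W x unfolding discrete_NS_def C_def by blast
    have eu: "(ut (Suc n) x - u n x) /\<^sub>R \<tau> = - ((1/2) *\<^sub>R C (u n) v x)
        + (\<Sum>j\<in>UNIV. snd_diff h j (ut (Suc n)) x) + mean_force h \<tau> f n x"
      using U x unfolding discrete_NS_def C_def v_def by blast
    have "(b x - E x) /\<^sub>R \<tau> = (wt (Suc n) x - w n x) /\<^sub>R \<tau> - (ut (Suc n) x - u n x) /\<^sub>R \<tau>"
      by (simp add: b_def E_def algebra_simps)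
    also have "\<dots> = - ((1/2) *\<^sub>R (C (w n) (wt (Suc n)) x - C (u n) v x)) + (\<Sum>j\<in>UNIV. snd_diff h j b x)"
      unfolding ew eu b_def snd_diff_diff sum_subtractf by (simp add: algebra_simps)
    finally show ?thesis unfolding split .
  qed
  have "(\<Sum>x\<in>S. b x \<bullet> (b x - E x)) / \<tau>
      = (\<Sum>x\<in>S. b x \<bullet> (- ((1/2) *\<^sub>R (C (w n) b x + C E v x)) + (\<Sum>j\<in>UNIV. snd_diff h j b x)))"
    unfolding sum_divide_distrib
  proof (intro sum.cong refl)
    fix x assume "x \<in> S"
    show "b x \<bullet> (b x - E x) / \<tau>
      = b x \<bullet> (- ((1/2) *\<^sub>R (C (w n) b x + C E v x)) + (\<Sum>j\<in>UNIV. snd_diff h j b x))"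
    proof (cases "x \<in> bdry \<Omega> h")
      case False
      hence x: "x \<in> inner_grid \<Omega> h" using \<open>x \<in> S\<close> by (simp add: S_def)
      show ?thesis
        by (simp only: pt[OF x, symmetric] inner_scaleR_right divide_inverse_commute[of _ \<tau>])
    qed (simp add: bb)
  qed
  also have "\<dots> = (\<Sum>x\<in>S. b x \<bullet> (\<Sum>j\<in>UNIV. snd_diff h j b x)
      - (b x \<bullet> C (w n) b x) / 2 - (b x \<bullet> C E v x) / 2)"
    by (intro sum.cong refl) (simp add: inner_add_right inner_diff_right field_simps)
  also have "\<dots> = - ((\<Sum>x\<in>S. b x \<bullet> C (w n) b x) + (\<Sum>x\<in>S. b x \<bullet> C E v x)) / 2 - G"
    unfolding G_def sum_subtractf sum_divide_distrib[symmetric] by simp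
  \<comment> \<open>With \<open>b\<close> in both slots the antisymmetric form equals its own
    negative.\<close>
  also have "(\<Sum>x\<in>S. b x \<bullet> C (w n) b x) = 0"
    using convection_form_eq[OF S, of "w n" b h b] convection_form_antisym[OF S, of "w n" b h b] w0 b0 divw
    by (simp add: C_def)
  also have "(\<Sum>x\<in>S. b x \<bullet> C E v x) = - convection_form S h E b v"
    using convection_form_eq[OF S, of E b h v] convection_form_antisym[OF S, of E b h v] E0 b0 divE
    by (simp add: C_def)
  finally have main: "(\<Sum>x\<in>S. b x \<bullet> (b x - E x)) / \<tau> = convection_form S h E b v / 2 - G" by simp
  have "convection_form S h E b v \<le> \<beta>\<^sup>2 * nE + G"
  proof -
    have "convection_form S h E b v
        \<le> \<beta>\<^sup>2 * nE + (\<Sum>j\<in>UNIV. \<Sum>x\<in>S. (norm (ctr_diff h j b x))\<^sup>2)"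
      using convection_form_le[of v \<beta> S h E b] v
      by (simp add: nE_def sum.distrib sum_distrib_left sum.swap[of _ S])
    also have "(\<Sum>j\<in>UNIV. \<Sum>x\<in>S. (norm (ctr_diff h j b x))\<^sup>2)
        \<le> (\<Sum>j\<in>UNIV. - (\<Sum>x\<in>S. b x \<bullet> snd_diff h j b x))"
      using b0 by (intro sum_mono sum_ctr_diff_le[OF S])
    also have "\<dots> = G" unfolding G_def sum_negf inner_sum_right by (subst sum.swap) simp
    finally show ?thesis by simp
  qed
  \<comment> \<open>The convection term enters with factor 1/2, so it consumes only half of
    \<open>G\<close>.\<close>
  hence "(\<Sum>x\<in>S. b x \<bullet> (b x - E x)) / \<tau> \<le> (\<beta>\<^sup>2 * nE - G) / 2"
    unfolding main by simp
  hence "(\<Sum>x\<in>S. b x \<bullet> (b x - E x)) \<le> \<tau> * ((\<beta>\<^sup>2 * nE - G) / 2)"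
    using \<tau>(1) by (simp only: pos_divide_le_eq mult.commute)
  moreover have "(nb - nE) / 2 \<le> (\<Sum>x\<in>S. b x \<bullet> (b x - E x))"
  proof -
    have "(\<Sum>x\<in>S. b x \<bullet> E x) \<le> (\<Sum>x\<in>S. ((norm (b x))\<^sup>2 + (norm (E x))\<^sup>2) / 2)"
      by (intro sum_mono young)
    also have "\<dots> = (nb + nE) / 2" by (simp add: nE_def nb_def sum.distrib sum_divide_distrib[symmetric])
    finally show ?thesis
      by (simp add: inner_diff_right sum_subtractf dot_square_norm nb_def[symmetric])
  qed
  ultimately have "nb - nE \<le> \<tau> * (\<beta>\<^sup>2 * nE - G)" by simp
  moreover have "\<tau> * (3 * (1 / A\<^sup>2) * nb) \<le> \<tau> * G"
    using poinc A \<tau>(1) by (intro mult_left_mono) (auto simp: field_simps)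
  moreover define s where "s = 1 / A\<^sup>2 * \<tau>"
  moreover have "\<beta>\<^sup>2 = 1 / A\<^sup>2 / 16" by (simp add: \<beta>_def power2_eq_square field_simps)
  \<comment> \<open>Here \<open>\<tau> * \<beta>\<^sup>2\<close> equals \<open>s / 16\<close>, and
    Poincare has bounded \<open>\<tau> * G\<close> below by \<open>3 * s * nb\<close>.\<close>
  ultimately have "(1 + 3 * s) * nb \<le> (1 + s / 16) * nE"
    by (simp add: algebra_simps)
  also have "\<dots> \<le> (1 + s / 16) * ne"
    using nEe \<tau>(1) by (intro mult_left_mono) (auto simp: s_def)
  finally have fin: "(1 + 3 * s) * nb \<le> (1 + s / 16) * ne" .
  have A2: "1 \<le> A\<^sup>2" using A by simp
  have s: "0 \<le> s" "s \<le> 1" using \<tau> A2 by (auto simp: s_def divide_le_eq)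
  have ne0: "0 \<le> nb" "0 \<le> ne" by (auto simp: nb_def ne_def intro: sum_nonneg)
  have "(1 + s / 16) * (exp s * nb) = exp s * (1 + s / 16) * nb" by simp
  also have "\<dots> \<le> (1 + 3 * s) * nb"
    using exp_mult_le[OF s] ne0 by (intro mult_right_mono)
  also note fin
  finally have "exp s * nb \<le> ne" using s(1) by (simp add: mult_le_cancel_left_pos)
  hence "nb \<le> exp (- s) * ne" by (simp add: exp_minus field_simps)
  thus ?thesis by (simp add: nb_def ne_def b_def e_def S_def s_def)
qed

lemma grid_norm_eq:
  "grid_norm \<Omega> h u = sqrt (h^3) * sqrt (\<Sum>x\<in>grid_domain \<Omega> h. (norm (u x))\<^sup>2)"
  by (simp add: grid_norm_def real_sqrt_mult[symmetric] sum_distrib_left mult.commute)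

text \<open>Passing from squared norms to norms halves the rate. Smallness is asked from index 1 on,
  because each step uses it for the new iterate.\<close>

lemma discrete_NS_decay:
  assumes bd: "bounded \<Omega>" and h: "0 < h" and \<tau>: "0 < \<tau>" "\<tau> \<le> 1" and A: "1 \<le> A"
    and P: "discrete_poincare \<Omega> h A"
    and U: "discrete_NS \<Omega> h \<tau> f ut u" and W: "discrete_NS \<Omega> h \<tau> f wt w"
    and small: "\<And>n x. 1 \<le> n \<Longrightarrow> x \<in> grid_domain \<Omega> h \<Longrightarrow> norm (ut n x) \<le> inverse A / 4"
  shows "grid_norm \<Omega> h (\<lambda>x. wt n x - ut n x)
    \<le> exp (- ((1 / A\<^sup>2) / 2) * real n * \<tau>) * grid_norm \<Omega> h (\<lambda>x. wt 0 x - ut 0 x)"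
proof (induction n)
  case 0
  show ?case by simp
next
  case (Suc n)
  let ?s = "1 / A\<^sup>2 * \<tau>"
  have "(\<Sum>x\<in>grid_domain \<Omega> h. (norm (wt (Suc n) x - ut (Suc n) x))\<^sup>2)
      \<le> (exp (- (?s / 2)))\<^sup>2 * (\<Sum>x\<in>grid_domain \<Omega> h. (norm (wt n x - ut n x))\<^sup>2)"
    using discrete_NS_contraction_step[OF bd h \<tau> A P U W, of n] small
    by (simp add: exp_double[symmetric])
  from real_sqrt_le_mono[OF this]
  have "grid_norm \<Omega> h (\<lambda>x. wt (Suc n) x - ut (Suc n) x)
      \<le> exp (- (?s / 2)) * grid_norm \<Omega> h (\<lambda>x. wt n x - ut n x)"
    using h unfolding grid_norm_eq by (simp add: real_sqrt_mult mult.left_commute)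
  also have "\<dots> \<le> exp (- (?s / 2)) *
      (exp (- ((1 / A\<^sup>2) / 2) * real n * \<tau>) * grid_norm \<Omega> h (\<lambda>x. wt 0 x - ut 0 x))"
    by (intro mult_left_mono Suc.IH) auto
  also have "\<dots> = exp (- ((1 / A\<^sup>2) / 2) * real (Suc n) * \<tau>) * grid_norm \<Omega> h (\<lambda>x. wt 0 x - ut 0 x)"
    by (simp add: mult.assoc[symmetric] exp_add[symmetric]) (simp add: add_divide_distrib algebra_simps)
  finally show ?case .
qed

text \<open>Taking the Poincare constant at least 1 makes \<open>A\<^sup>-\<^sup>2 \<tau> \<le> 1\<close>, which the implicit scheme needs
  in order to beat the exponential rate in a single step.\<close>

theorem theorem4p4:
  shows "\<exists>A :: real \<Rightarrow> real.
    (\<forall>d. 0 < A d) \<and>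
    (\<forall>\<Omega> h. lipschitz_domain \<Omega> \<and> 0 < h \<longrightarrow> discrete_poincare \<Omega> h (A (diameter \<Omega>))) \<and>
    (\<forall>\<Omega> (f :: real \<Rightarrow> real^3 \<Rightarrow> real^3) (h::real) (T1::nat) (\<tau>::real) (R::real) ut u wt w.
       lipschitz_domain \<Omega> \<and>
       L2_loc \<Omega> f \<and> time_periodic \<Omega> f \<and>
       0 < h \<and> (\<forall>p. double_step_connected h (core_class \<Omega> h p)) \<and>
       1 \<le> T1 \<and> \<tau> = 1 / real T1 \<and>
       R0 (A (diameter \<Omega>)) \<Omega> f \<le> R \<and>
       discrete_NS \<Omega> h \<tau> f ut u \<and> ut 0 \<in> U_ball \<Omega> h R \<and>
       (\<forall>n\<ge>1. \<forall>x\<in>grid_domain \<Omega> h. norm (ut n x) \<le> inverse (A (diameter \<Omega>)) / 4) \<and>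
       discrete_NS \<Omega> h \<tau> f wt w \<and> wt 0 \<in> U_ball \<Omega> h R \<and> wt 0 \<noteq> ut 0 \<longrightarrow>
       (\<forall>n. grid_norm \<Omega> h (\<lambda>x. wt n x - ut n x)
              \<le> exp (- ((1 / (A (diameter \<Omega>))\<^sup>2) / 2) * real n * \<tau>)
                 * grid_norm \<Omega> h (\<lambda>x. wt 0 x - ut 0 x)))"
\<comment> \<open>The constant \<open>2 * d\<close> comes from the weighted Poincare argument; the
  maximum with 1 also secures positivity for every real \<open>d\<close>.\<close>
proof (intro exI[of _ "\<lambda>d. max 1 (2 * d)"] conjI allI impI)
  fix d :: real
  show "0 < max 1 (2 * d)" by simp
next
  fix \<Omega> :: "(real^3) set" and h :: real
  assume "lipschitz_domain \<Omega> \<and> 0 < h"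
  thus "discrete_poincare \<Omega> h (max 1 (2 * diameter \<Omega>))"
    by (intro discrete_poincare_diameter) (auto simp: lipschitz_domain_def)
next
  fix \<Omega> :: "(real^3) set" and f :: "real \<Rightarrow> real^3 \<Rightarrow> real^3" and h \<tau> R :: real and T1 n :: nat
    and ut u wt w :: "nat \<Rightarrow> real^3 \<Rightarrow> real^3"
  let ?A = "max 1 (2 * diameter \<Omega>)"
  assume H: "lipschitz_domain \<Omega> \<and>
       L2_loc \<Omega> f \<and> time_periodic \<Omega> f \<and>
       0 < h \<and> (\<forall>p. double_step_connected h (core_class \<Omega> h p)) \<and>
       1 \<le> T1 \<and> \<tau> = 1 / real T1 \<and>
       R0 ?A \<Omega> f \<le> R \<and>
       discrete_NS \<Omega> h \<tau> f ut u \<and> ut 0 \<in> U_ball \<Omega> h R \<and>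
       (\<forall>n\<ge>1. \<forall>x\<in>grid_domain \<Omega> h. norm (ut n x) \<le> inverse ?A / 4) \<and>
       discrete_NS \<Omega> h \<tau> f wt w \<and> wt 0 \<in> U_ball \<Omega> h R \<and> wt 0 \<noteq> ut 0"
  hence bd: "bounded \<Omega>" and h: "0 < h" by (auto simp: lipschitz_domain_def)
  have \<tau>: "0 < \<tau>" "\<tau> \<le> 1" using H by (auto simp: divide_le_eq)
  show "grid_norm \<Omega> h (\<lambda>x. wt n x - ut n x)
    \<le> exp (- ((1 / ?A\<^sup>2) / 2) * real n * \<tau>) * grid_norm \<Omega> h (\<lambda>x. wt 0 x - ut 0 x)"
    by (rule discrete_NS_decay[OF bd h \<tau> _ discrete_poincare_diameter[OF bd h], of _ f ut u wt w])
      (use H in auto)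
qed

end
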